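(* Let $N>2$, let $\tilde K$ be an $N\times N$ random matrix whose entries are independent and identically distributed according to a complex Gaussian law centered at $0$ and of variance $1$, and let $K=\tilde K/N^2$. Then for any $0<\delta\le N^{-3}$ and any $\sigma>0$, with probability at least $1-26/N^2$, we have both $$\mathrm{Spec}(J+\delta K)\subseteq D\bigl(0,(\delta N)^{1/N}\bigr)$$ and $$\#\Bigl(\mathrm{Spec}(J+\delta K)\cap D\bigl(0,(\delta N)^{1/N}e^{-\sigma}\bigr)\Bigr)\le\frac4\sigma\ln N.$$
   Context: $J$ is the $N\times N$ Jordan matrix with $J_{r,s}=1$ if $s=r+1$ and $J_{r,s}=0$ otherwise ($r,s=1,\dots,N$). $\mathrm{Spec}$ denotes the spectrum (set of eigenvalues) of a matrix, $D(w,r)=\{z\in\mathbf{C}:|z-w|\le r\}$, and $\#$ the number of elements. The complex Gaussian law centered at $0$ of variance $1$ is the circularly symmetric one, with mean $0$ and $E|w|^2=1$. *)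

theory Defs
  imports "HOL-Probability.Probability" "Jordan_Normal_Form.Spectral_Radius"
begin

definition std_complex_gaussian_density :: "complex \<Rightarrow> real" where
  "std_complex_gaussian_density z = exp (- (cmod z)\<^sup>2) / pi"

text \<open>
  Real and imaginary parts are independent real Gaussians with mean 0 and variance 1/2,
  so that the expectation of \<open>(cmod z)\<^sup>2\<close> is 1.
\<close>
lemma std_complex_gaussian_density_Re_Im:
  "std_complex_gaussian_density z
     = normal_density 0 (1 / sqrt 2) (Re z) * normal_density 0 (1 / sqrt 2) (Im z)"
proof -
  have "exp (- (cmod z)\<^sup>2) = exp (- (Re z)\<^sup>2) * exp (- (Im z)\<^sup>2)"
    by (simp add: cmod_power2 exp_add [symmetric])
  thus ?thesis
    by (simp add: std_complex_gaussian_density_def normal_density_def power_divide)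
qed

text \<open>
  Matrix indices start at 0. The conjunct on \<open>distributed\<close> says that every entry has the
  standard complex Gaussian as its law; \<open>lborel\<close> here is Lebesgue measure on the plane.
\<close>
definition std_complex_gaussian_matrix ::
    "'w measure \<Rightarrow> nat \<Rightarrow> ('w \<Rightarrow> complex mat) \<Rightarrow> bool" where
  "std_complex_gaussian_matrix M N A \<longleftrightarrow>
     (\<forall>\<omega>\<in>space M. A \<omega> \<in> carrier_mat N N) \<and>
     prob_space.indep_vars M (\<lambda>_. borel) (\<lambda>(r, s) \<omega>. A \<omega> $$ (r, s)) ({..<N} \<times> {..<N}) \<and>
     (\<forall>r<N. \<forall>s<N. distributed M lborel (\<lambda>\<omega>. A \<omega> $$ (r, s)) std_complex_gaussian_density)"

definition jordan_J :: "nat \<Rightarrow> complex mat" where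
  "jordan_J N = mat N N (\<lambda>(r, s). if s = r + 1 then 1 else 0)"

lemma jordan_J_eq_jordan_block: "jordan_J N = jordan_block N 0"
  by (rule eq_matI) (auto simp: jordan_J_def jordan_block_def)

end

theory Submission imports Defs begin

text \<open>
  Write \<open>B\<close> for the perturbation \<open>\<delta> K\<close>. It has two relevant sizes: the sum of the absolute
  values of its entries, and the lower left entry, which is the only one that enters
  \<open>det (J + B)\<close> to first order. Both conclusions hold on the event where

  \<^item> the entries of \<open>B\<close> sum up in absolute value to at most \<open>\<epsilon> = \<delta> N\<close>, and

  \<^item> \<open>\<bar>det (J + B)\<bar> \<ge> \<eta> = \<delta> / N ^ 3\<close>.

  \<^emph>\<open>Localization.\<close> Along the chain of a nilpotent Jordan block an eigenvector of \<open>J + B\<close> satisfies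
  \<open>v\<^sub>i\<^sub>+\<^sub>1 = z v\<^sub>i - (B v)\<^sub>i\<close>. Unrolling this down to the end of the chain shows that \<open>\<bar>z\<bar> ^ N \<le> \<epsilon>\<close>
  (\<open>norm_eigenvalue_perturbed_jordan\<close>), so every eigenvalue lies in the disc of radius
  \<open>R = \<epsilon> powr (1 / N)\<close>.

  \<^emph>\<open>Counting.\<close> Since all \<open>N\<close> eigenvalues lie in that disc and their product is the determinant,
  \<open>n\<close> eigenvalues in the disc of radius \<open>R exp (- \<sigma>)\<close> force
  \<open>\<eta> \<le> \<bar>det (J + B)\<bar> \<le> R ^ N exp (- \<sigma> n)\<close>, that is \<open>\<sigma> n \<le> ln (\<epsilon> / \<eta>) = 4 ln N\<close>
  (\<open>spectrum_perturbed_jordan\<close>). This takes the place of Jensen's formula.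

  \<^emph>\<open>Probability.\<close> The first bound on \<open>B\<close> fails with probability at most \<open>4 / N\<^sup>2\<close> by Markov's
  inequality for the sum of the squared entries. For the determinant, expand along the last
  row: \<open>det (J + B)\<close> is an affine function of the lower left entry, and its slope is the determinant
  of an \<open>(N - 1) \<times> (N - 1)\<close> matrix, up to sign. Where the first bound holds, this matrix is so close to the
  identity that the slope has modulus at least \<open>1 / 2\<close>. A small determinant
  therefore traps the lower left Gaussian entry in a disc of radius \<open>2 / N\<close> around a point that depends
  only on the other entries (\<open>corner_entry_near_if_det_small\<close>); as these are independent of it
  and its density is at most \<open>1 / \<pi>\<close>, this has probability at most \<open>4 / N\<^sup>2\<close>
  (\<open>prob_det_perturbed_jordan_small\<close>).

  The statement speaks of the measure of a set defined through the spectrum, so the measurability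
  of that set has to be established too. It follows from the fact that for a compact \<open>C\<close> the matrices with an
  eigenvalue in \<open>C\<close> form a measurable set.
\<close>

(* This leaves the infix $ to the entries of vectors of variable dimension. *)
unbundle no vec_syntax

section \<open>Eigenvalues and determinants of perturbed matrices\<close>

lemma norm_mult_mat_vec_index_le:
  fixes B :: "complex mat"
  assumes B: "B \<in> carrier_mat n n" and v: "v \<in> carrier_vec n"
    and m: "\<And>j. j < n \<Longrightarrow> cmod (v $ j) \<le> m" and i: "i < n"
  shows "cmod ((B *\<^sub>v v) $ i) \<le> (\<Sum>j<n. cmod (B $$ (i, j))) * m"
proof -
  have "(B *\<^sub>v v) $ i = (\<Sum>j<n. B $$ (i, j) * v $ j)"
    using B v i by (simp add: scalar_prod_def atLeast0LessThan)
  also have "cmod \<dots> \<le> (\<Sum>j<n. cmod (B $$ (i, j) * v $ j))"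
    by (rule norm_sum)
  also have "\<dots> \<le> (\<Sum>j<n. cmod (B $$ (i, j)) * m)"
    by (rule sum_mono) (auto simp: norm_mult intro!: mult_left_mono m)
  finally show ?thesis
    by (simp add: sum_distrib_right)
qed

lemma nonzero_vec_max_index:
  fixes v :: "complex vec"
  assumes v: "v \<in> carrier_vec n" "v \<noteq> 0\<^sub>v n"
  obtains i where "i < n" "0 < cmod (v $ i)" "\<And>j. j < n \<Longrightarrow> cmod (v $ j) \<le> cmod (v $ i)"
proof -
  obtain k where k: "k < n" "v $ k \<noteq> 0"
    using v by (metis carrier_vecD eq_vecI index_zero_vec)
  let ?A = "(\<lambda>j. cmod (v $ j)) ` {..<n}"
  have "Max ?A \<in> ?A"
    using k by (intro Max_in) auto
  then obtain i where i: "i < n" "Max ?A = cmod (v $ i)"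
    by auto
  have max: "cmod (v $ j) \<le> cmod (v $ i)" if "j < n" for j
    unfolding i(2)[symmetric] using that by (intro Max_ge) auto
  moreover have "0 < cmod (v $ i)"
    using max[OF k(1)] k(2) by (meson less_le_trans zero_less_norm_iff)
  ultimately show thesis
    using that i(1) by blast
qed

text \<open>
  Evaluate the eigenvector equation at a coordinate where the eigenvector is largest.
\<close>

lemma norm_eigenvalue_le_sum_entries:
  fixes B :: "complex mat"
  assumes B: "B \<in> carrier_mat n n" and z: "eigenvalue B z"
  shows "cmod z \<le> (\<Sum>i<n. \<Sum>j<n. cmod (B $$ (i, j)))"
proof -
  obtain v where v: "v \<in> carrier_vec n" "v \<noteq> 0\<^sub>v n" "B *\<^sub>v v = z \<cdot>\<^sub>v v"
    using z B by (auto simp: eigenvalue_def eigenvector_def)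
  obtain i where i: "i < n" "0 < cmod (v $ i)"
    and max: "\<And>j. j < n \<Longrightarrow> cmod (v $ j) \<le> cmod (v $ i)"
    using nonzero_vec_max_index[OF v(1,2)] by blast
  have "cmod z * cmod (v $ i) = cmod ((B *\<^sub>v v) $ i)"
    using v i by (simp add: norm_mult)
  also have "\<dots> \<le> (\<Sum>j<n. cmod (B $$ (i, j))) * cmod (v $ i)"
    by (rule norm_mult_mat_vec_index_le[OF B v(1) max i(1)])
  finally have "cmod z \<le> (\<Sum>j<n. cmod (B $$ (i, j)))"
    using i by simp
  also have "\<dots> \<le> (\<Sum>i<n. \<Sum>j<n. cmod (B $$ (i, j)))"
    using i by (intro member_le_sum[of i _ "\<lambda>i. \<Sum>j<n. cmod (B $$ (i, j))"] sum_nonneg) auto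
  finally show ?thesis .
qed

text \<open>
  With \<open>u = B v\<close>, the eigenvector equation reads \<open>z v\<^sub>i = v\<^sub>i\<^sub>+\<^sub>1 + u\<^sub>i\<close> with \<open>v\<^sub>N = 0\<close>, so that
  \<open>z ^ (N - i) v\<^sub>i\<close> is a combination of \<open>u\<^sub>i, \<dots>, u\<^sub>N\<^sub>-\<^sub>1\<close> with powers of \<open>z\<close> as coefficients.
  As soon as these powers are at most \<open>1\<close> in absolute value, the sum of the \<open>\<bar>u\<^sub>k\<bar>\<close> bounds \<open>\<bar>z\<bar> ^ N\<close> times
  the largest \<open>\<bar>v\<^sub>i\<bar>\<close>, and it is itself at most \<open>\<epsilon>\<close> times that number.
\<close>

lemma norm_eigenvalue_perturbed_jordan:
  assumes B: "B \<in> carrier_mat N N"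
    and S: "(\<Sum>i<N. \<Sum>j<N. cmod (B $$ (i, j))) \<le> \<epsilon>" and \<epsilon>: "\<epsilon> < 1"
    and z: "eigenvalue (jordan_J N + B) z"
  shows "cmod z ^ N \<le> \<epsilon>"
proof -
  have J: "jordan_J N \<in> carrier_mat N N"
    by (simp add: jordan_J_def)
  obtain v where v: "v \<in> carrier_vec N" "v \<noteq> 0\<^sub>v N"
    and eq: "(jordan_J N + B) *\<^sub>v v = z \<cdot>\<^sub>v v"
    using z B J by (auto simp: eigenvalue_def eigenvector_def)
  define u where "u = B *\<^sub>v v"
  \<comment> \<open>The moduli of the \<open>v\<^sub>i\<close>, extended by \<open>v\<^sub>N = 0\<close>.\<close>
  define w where "w i = (if i < N then cmod (v $ i) else 0)" for i
  \<comment> \<open>Truncating \<open>\<bar>z\<bar>\<close> at \<open>1\<close> treats eigenvalues inside and outside the unit disc alike;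
    the resulting bound \<open>t ^ N \<le> \<epsilon> < 1\<close> excludes the latter afterwards.\<close>
  define t where "t = min (cmod z) 1"
  have t: "0 \<le> t" "t \<le> 1" "t \<le> cmod z"
    by (auto simp: t_def)
  have Jv: "(jordan_J N *\<^sub>v v) $ i = (if Suc i < N then v $ Suc i else 0)" if "i < N" for i
  proof -
    have "(jordan_J N *\<^sub>v v) $ i = (\<Sum>j<N. (if j = Suc i then 1 else 0) * v $ j)"
      using v that by (simp add: jordan_J_def scalar_prod_def atLeast0LessThan)
    also have "\<dots> = (\<Sum>j<N. if j = Suc i then v $ j else 0)"
      by (rule sum.cong) auto
    finally show ?thesis
      by simp
  qed
  have rec: "t * w i \<le> w (Suc i) + cmod (u $ i)" if i: "i < N" for i
  proof -
    have "z * v $ i = (jordan_J N *\<^sub>v v) $ i + u $ i"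
      using arg_cong[OF eq, of "\<lambda>x. x $ i"] v i B J
      by (simp add: u_def add_mult_distrib_mat_vec[OF J B v(1)])
    then have "cmod z * cmod (v $ i) = cmod ((if Suc i < N then v $ Suc i else 0) + u $ i)"
      unfolding Jv[OF i] by (metis norm_mult)
    also have "\<dots> \<le> w (Suc i) + cmod (u $ i)"
      by (rule order_trans[OF norm_triangle_ineq]) (auto simp: w_def)
    finally show ?thesis
      using i t mult_right_mono[of t "cmod z" "cmod (v $ i)"] by (simp add: w_def)
  qed
  have iter: "t ^ (N - i) * w i \<le> (\<Sum>k=i..<N. cmod (u $ k))" if "i \<le> N" for i
    using that
  proof (induction i rule: inc_induct)
    case base
    show ?case by (simp add: w_def)
  next
    case (step i)
    have "t ^ (N - i) * w i = t ^ (N - Suc i) * (t * w i)"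
      using step.hyps by (metis Suc_diff_Suc mult.assoc power_Suc2)
    also have "\<dots> \<le> t ^ (N - Suc i) * (w (Suc i) + cmod (u $ i))"
      using rec[OF step.hyps(2)] t by (intro mult_left_mono) auto
    also have "\<dots> \<le> t ^ (N - Suc i) * w (Suc i) + cmod (u $ i)"
      using t by (simp add: distrib_left mult_left_le_one_le power_le_one)
    also have "\<dots> \<le> (\<Sum>k=i..<N. cmod (u $ k))"
      using step by (simp add: sum.atLeast_Suc_lessThan)
    finally show ?case .
  qed
  obtain i where i: "i < N" "0 < cmod (v $ i)"
    and max: "\<And>j. j < N \<Longrightarrow> cmod (v $ j) \<le> cmod (v $ i)"
    using nonzero_vec_max_index[OF v] by blast
  let ?m = "cmod (v $ i)"
  have "t ^ N * ?m \<le> t ^ (N - i) * w i"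
    using i t by (auto simp: w_def intro!: mult_right_mono power_decreasing)
  also have "\<dots> \<le> (\<Sum>k=i..<N. cmod (u $ k))"
    using iter i by simp
  also have "\<dots> \<le> (\<Sum>k<N. cmod (u $ k))"
    by (rule sum_mono2) auto
  also have "\<dots> \<le> (\<Sum>k<N. (\<Sum>j<N. cmod (B $$ (k, j))) * ?m)"
    unfolding u_def by (intro sum_mono norm_mult_mat_vec_index_le[OF B v(1) max]) auto
  also have "\<dots> \<le> \<epsilon> * ?m"
    unfolding sum_distrib_right[symmetric] using S by (intro mult_right_mono) auto
  finally have tN: "t ^ N \<le> \<epsilon>"
    using i by simp
  then have "t \<noteq> 1"
    using \<epsilon> by auto
  then have "t = cmod z"
    by (auto simp: t_def min_def split: if_splits)
  with tN show ?thesis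
    by simp
qed

text \<open>
  The list repeats each eigenvalue according to its algebraic multiplicity, so its length is
  known even though the spectrum may have fewer elements.
\<close>

lemma det_eq_prod_eigenvalues:
  fixes A :: "complex mat"
  assumes A: "A \<in> carrier_mat n n"
  obtains as where "length as = n" "set as = spectrum A" "Determinant.det A = prod_list as"
proof -
  obtain as where as: "char_poly A = (\<Prod>a\<leftarrow>as. [:- a, 1:])" "length as = n"
    using char_poly_factorized[OF A] by auto
  have "poly (\<Prod>a\<leftarrow>as. [:- a, 1:]) x = (\<Prod>a\<leftarrow>as. x - a)" for x
    by (induction as) (auto simp: algebra_simps)
  then have p: "poly (char_poly A) x = (\<Prod>a\<leftarrow>as. x - a)" for x
    using as by simp
  have 1: "set as = spectrum A"
    unfolding spectrum_root_char_poly[OF A] p by (auto simp: prod_list_zero_iff)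
  have "(-1) ^ n * Determinant.det A = Determinant.det ((-1) \<cdot>\<^sub>m A)"
    using A by simp
  also have "(-1) \<cdot>\<^sub>m A = - (char_matrix A 0)"
    using A by (intro eq_matI) (auto simp: char_matrix_def)
  also have "Determinant.det \<dots> = (\<Prod>a\<leftarrow>as. 0 - a)"
    using char_poly_matrix[OF A, of 0] p[of 0] by simp
  also have "\<dots> = (-1) ^ length as * prod_list as"
    by (induction as) auto
  finally have "Determinant.det A = prod_list as"
    using as by simp
  with 1 as(2) show thesis
    using that by blast
qed

text \<open>
  All eigenvalues of \<open>1 + E\<close> have modulus at least \<open>1 - \<epsilon>\<close>; take their product and apply Bernoulli's
  inequality.
\<close>

lemma norm_det_one_plus_ge:
  assumes E: "E \<in> carrier_mat n n"
    and S: "(\<Sum>i<n. \<Sum>j<n. cmod (E $$ (i, j))) \<le> \<epsilon>" and \<epsilon>: "\<epsilon> \<le> 1"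
  shows "1 - real n * \<epsilon> \<le> cmod (Determinant.det (1\<^sub>m n + E))"
proof -
  have A: "1\<^sub>m n + E \<in> carrier_mat n n"
    using E by simp
  obtain as where as: "length as = n" "set as = spectrum (1\<^sub>m n + E)"
    "Determinant.det (1\<^sub>m n + E) = prod_list as"
    using det_eq_prod_eigenvalues[OF A] .
  have "1 - \<epsilon> \<le> cmod a" if "a \<in> set as" for a
  proof -
    have "eigenvalue (1\<^sub>m n + E) a"
      using that as(2) by (simp add: spectrum_def)
    then obtain v where v: "v \<in> carrier_vec n" "v \<noteq> 0\<^sub>v n" "(1\<^sub>m n + E) *\<^sub>v v = a \<cdot>\<^sub>v v"
      using E by (auto simp: eigenvalue_def eigenvector_def)
    have "v + E *\<^sub>v v = a \<cdot>\<^sub>v v"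
      using v(3) E v(1) by (simp add: add_mult_distrib_mat_vec[of _ n n])
    then have "v $ i + (E *\<^sub>v v) $ i = a * v $ i" if "i < n" for i
      using that v(1) E by (metis index_add_vec(1) index_smult_vec(1) carrier_vecD carrier_matD(1) dim_mult_mat_vec)
    then have "E *\<^sub>v v = (a - 1) \<cdot>\<^sub>v v"
      using v(1) E by (intro eq_vecI) (auto simp: algebra_simps simp del: index_mult_mat_vec)
    then have "eigenvalue E (a - 1)"
      using v E by (auto simp: eigenvalue_def eigenvector_def)
    then have "cmod (a - 1) \<le> \<epsilon>"
      using norm_eigenvalue_le_sum_entries[OF E] S by fastforce
    then show ?thesis
      using norm_triangle_ineq2[of 1 "1 - a"] by (simp add: norm_minus_commute)
  qed
  then have "(1 - \<epsilon>) ^ length as \<le> cmod (prod_list as)"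
    using \<epsilon> by (induction as) (auto simp: norm_mult intro!: mult_mono)
  moreover have "1 - real n * \<epsilon> \<le> (1 - \<epsilon>) ^ n"
    using Bernoulli_inequality[of "-\<epsilon>" n] \<epsilon> by simp
  ultimately show ?thesis
    using as by simp
qed

text \<open>
  Each of the \<open>n\<close> factors of the determinant contributes at most \<open>R\<close>, and each eigenvalue in the smaller
  disc saves a further factor \<open>exp (- \<sigma>)\<close>. Counting the elements of the spectrum ignores multiplicities,
  which only weakens the saving.
\<close>

lemma norm_det_le_exp_card_small_eigenvalues:
  fixes A :: "complex mat"
  assumes A: "A \<in> carrier_mat n n" and R: "spectrum A \<subseteq> cball 0 R" and \<sigma>: "0 \<le> \<sigma>" and R0: "0 \<le> R"
  shows "cmod (Determinant.det A)
           \<le> R ^ n * exp (- \<sigma> * real (card (spectrum A \<inter> cball 0 (R * exp (- \<sigma>)))))"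
proof -
  obtain as where as: "length as = n" "set as = spectrum A"
    "Determinant.det A = prod_list as"
    using det_eq_prod_eigenvalues[OF A] .
  let ?P = "\<lambda>a. a \<in> cball 0 (R * exp (- \<sigma>))"
  have "\<forall>a\<in>set as. cmod a \<le> R"
    using as R by auto
  then have "cmod (prod_list as) \<le> R ^ length as * exp (- \<sigma> * real (length (filter ?P as)))"
  proof (induction as)
    case (Cons a as)
    have "cmod a \<le> R * (if ?P a then exp (- \<sigma>) else 1)"
      using Cons.prems by simp
    then have "cmod (prod_list (a # as))
        \<le> (R * (if ?P a then exp (- \<sigma>) else 1))
            * (R ^ length as * exp (- \<sigma> * real (length (filter ?P as))))"
      using Cons R0 by (auto simp: norm_mult intro!: mult_mono)
    also have "\<dots> = R ^ length (a # as) * exp (- \<sigma> * real (length (filter ?P (a # as))))"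
      by (simp add: algebra_simps flip: exp_add)
    finally show ?case .
  qed simp
  also have "\<dots> \<le> R ^ length as * exp (- \<sigma> * real (card (spectrum A \<inter> cball 0 (R * exp (- \<sigma>)))))"
  proof -
    have "card (spectrum A \<inter> cball 0 (R * exp (- \<sigma>))) = card (set (filter ?P as))"
      using as by (auto intro!: arg_cong[of _ _ card])
    also have "\<dots> \<le> length (filter ?P as)"
      by (rule card_length)
    finally show ?thesis
      using R0 \<sigma> by (intro mult_left_mono) (auto intro!: mult_left_mono)
  qed
  finally show ?thesis
    using as by simp
qed

text \<open>
  Multilinearity: as a function of a single entry the determinant is affine, with the cofactor as
  slope.
\<close>

lemma det_add_to_entry:
  fixes A :: "'a :: comm_ring_1 mat"
  assumes A: "A \<in> carrier_mat n n" and B: "B \<in> carrier_mat n n" and kl: "k < n" "l < n"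
    and same: "\<And>i j. i < n \<Longrightarrow> j < n \<Longrightarrow> (i, j) \<noteq> (k, l) \<Longrightarrow> B $$ (i, j) = A $$ (i, j)"
  shows "Determinant.det B
           = Determinant.det A + (B $$ (k, l) - A $$ (k, l)) * Determinant.cofactor A k l"
proof -
  have "mat_delete B k j = mat_delete A k j" if "j < n" for j
    using A B kl by (intro eq_matI) (auto simp: mat_delete_def intro!: same)
  then have cof: "Determinant.cofactor B k j = Determinant.cofactor A k j" if "j < n" for j
    using that by (simp add: Determinant.cofactor_def)
  have "Determinant.det B = (\<Sum>j<n. B $$ (k, j) * Determinant.cofactor A k j)"
    using laplace_expansion_row[OF B kl(1)] cof by simp
  also have "\<dots> = (\<Sum>j<n. A $$ (k, j) * Determinant.cofactor A k j
      + (if j = l then (B $$ (k, l) - A $$ (k, l)) * Determinant.cofactor A k l else 0))"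
    using kl same[of k] by (intro sum.cong) (auto simp: algebra_simps)
  also have "\<dots> = Determinant.det A + (B $$ (k, l) - A $$ (k, l)) * Determinant.cofactor A k l"
    using kl by (simp add: sum.distrib laplace_expansion_row[OF A kl(1)])
  finally show ?thesis .
qed

text \<open>
  Deleting the last row and the first column moves the superdiagonal of \<open>J\<close> to the diagonal, so the minor
  is the determinant of a perturbation of the identity.
\<close>

lemma norm_corner_cofactor_perturbed_jordan_ge:
  assumes N: "0 < N" and B: "B \<in> carrier_mat N N"
    and S: "(\<Sum>i<N. \<Sum>j<N. cmod (B $$ (i, j))) \<le> \<epsilon>" and \<epsilon>: "\<epsilon> \<le> 1"
  shows "1 - real (N - 1) * \<epsilon> \<le> cmod (Determinant.cofactor (jordan_J N + B) (N - 1) 0)"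
proof -
  define E where "E = mat_delete B (N - 1) 0"
  have E: "E \<in> carrier_mat (N - 1) (N - 1)"
    unfolding E_def by (rule mat_delete_carrier[OF B])
  have "mat_delete (jordan_J N + B) (N - 1) 0 = 1\<^sub>m (N - 1) + E"
    using B N by (intro eq_matI) (auto simp: mat_delete_def E_def jordan_J_def)
  then have "cmod (Determinant.cofactor (jordan_J N + B) (N - 1) 0)
      = cmod (Determinant.det (1\<^sub>m (N - 1) + E))"
    by (simp add: Determinant.cofactor_def norm_mult norm_power)
  moreover have "(\<Sum>i<N-1. \<Sum>j<N-1. cmod (E $$ (i, j))) \<le> \<epsilon>"
  proof -
    have "(\<Sum>i<N-1. \<Sum>j<N-1. cmod (E $$ (i, j))) = (\<Sum>i<N-1. \<Sum>j<N-1. cmod (B $$ (i, Suc j)))"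
      using B by (intro sum.cong) (auto simp: E_def mat_delete_def)
    also have "\<dots> = (\<Sum>i<N-1. \<Sum>j\<in>Suc ` {..<N-1}. cmod (B $$ (i, j)))"
      by (simp add: sum.reindex)
    also have "\<dots> \<le> (\<Sum>i<N-1. \<Sum>j<N. cmod (B $$ (i, j)))"
      using N by (intro sum_mono sum_mono2) auto
    also have "\<dots> \<le> (\<Sum>i<N. \<Sum>j<N. cmod (B $$ (i, j)))"
      by (intro sum_mono2 sum_nonneg) auto
    finally show ?thesis
      using S by simp
  qed
  ultimately show ?thesis
    using norm_det_one_plus_ge[OF E _ \<epsilon>] by simp
qed

section \<open>The deterministic estimates\<close>

text \<open>
  The deterministic form of the theorem: a bound on the entries of the perturbation and a lower bound
  on the determinant give both conclusions.
\<close>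

lemma spectrum_perturbed_jordan:
  assumes N: "0 < N" and B: "B \<in> carrier_mat N N"
    and S: "(\<Sum>i<N. \<Sum>j<N. cmod (B $$ (i, j))) \<le> \<epsilon>" and \<epsilon>: "0 < \<epsilon>" "\<epsilon> < 1"
    and \<eta>: "0 < \<eta>" "\<eta> \<le> cmod (Determinant.det (jordan_J N + B))" and \<sigma>: "0 < \<sigma>"
  defines "R \<equiv> \<epsilon> powr (1 / real N)"
  shows "spectrum (jordan_J N + B) \<subseteq> cball 0 R"
    and "real (card (spectrum (jordan_J N + B) \<inter> cball 0 (R * exp (- \<sigma>)))) \<le> ln (\<epsilon> / \<eta>) / \<sigma>"
proof -
  have RN: "R ^ N = \<epsilon>"
    using \<epsilon> N by (simp add: R_def powr_realpow[symmetric] powr_powr)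
  have R0: "0 \<le> R"
    by (simp add: R_def)
  show sub: "spectrum (jordan_J N + B) \<subseteq> cball 0 R"
  proof
    fix z assume "z \<in> spectrum (jordan_J N + B)"
    then have "cmod z ^ N \<le> R ^ N"
      using norm_eigenvalue_perturbed_jordan[OF B S \<epsilon>(2)] RN by (simp add: spectrum_def)
    then show "z \<in> cball 0 R"
      using N R0 by (simp add: power_mono_iff)
  qed
  let ?n = "real (card (spectrum (jordan_J N + B) \<inter> cball 0 (R * exp (- \<sigma>))))"
  have "jordan_J N + B \<in> carrier_mat N N"
    using B by simp
  then have "\<eta> \<le> \<epsilon> * exp (- \<sigma> * ?n)"
    using norm_det_le_exp_card_small_eigenvalues[OF _ sub, of N \<sigma>] \<sigma> R0 \<eta> RN by simp
  then have "exp (\<sigma> * ?n) \<le> \<epsilon> / \<eta>"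
    using \<eta>(1) by (simp add: exp_minus field_simps)
  then have "\<sigma> * ?n \<le> ln (\<epsilon> / \<eta>)"
    using \<epsilon> \<eta> by (subst ln_ge_iff) auto
  then show "?n \<le> ln (\<epsilon> / \<eta>) / \<sigma>"
    using \<sigma> by (simp add: field_simps)
qed

text \<open>
  The centre of the disc that confines the lower left entry \<open>B\<^sub>N\<^sub>-\<^sub>1\<^sub>,\<^sub>0\<close> is expressed through \<open>B0\<close>, which agrees
  with \<open>B\<close> except for a zero in that position; it is thus a function of the other entries alone.
\<close>

lemma corner_entry_near_if_det_small:
  assumes N: "0 < N" and B: "B \<in> carrier_mat N N" and B0: "B0 \<in> carrier_mat N N"
    and eq: "\<And>i j. i < N \<Longrightarrow> j < N \<Longrightarrow> B0 $$ (i, j) = (if (i, j) = (N - 1, 0) then 0 else B $$ (i, j))"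
    and S: "(\<Sum>i<N. \<Sum>j<N. cmod (B $$ (i, j))) \<le> \<epsilon>" and \<epsilon>: "\<epsilon> \<le> 1" "real (N - 1) * \<epsilon> \<le> 1 / 2"
    and small: "cmod (Determinant.det (jordan_J N + B)) \<le> \<eta>"
  shows "cmod (B $$ (N - 1, 0)
           - (- Determinant.det (jordan_J N + B0) / Determinant.cofactor (jordan_J N + B0) (N - 1) 0))
         \<le> 2 * \<eta>"
proof -
  let ?c = "Determinant.cofactor (jordan_J N + B0) (N - 1) 0"
  let ?x = "B $$ (N - 1, 0) - (- Determinant.det (jordan_J N + B0) / ?c)"
  have "(\<Sum>i<N. \<Sum>j<N. cmod (B0 $$ (i, j))) \<le> (\<Sum>i<N. \<Sum>j<N. cmod (B $$ (i, j)))"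
    by (intro sum_mono) (auto simp: eq)
  then have "1 - real (N - 1) * \<epsilon> \<le> cmod ?c"
    using S by (intro norm_corner_cofactor_perturbed_jordan_ge[OF N B0 _ \<epsilon>(1)]) simp
  then have c: "1 / 2 \<le> cmod ?c"
    using \<epsilon>(2) by linarith
  then have "?c \<noteq> 0"
    by auto
  have "Determinant.det (jordan_J N + B)
      = Determinant.det (jordan_J N + B0)
        + ((jordan_J N + B) $$ (N - 1, 0) - (jordan_J N + B0) $$ (N - 1, 0)) * ?c"
    using N B B0 by (intro det_add_to_entry[of _ N]) (auto simp: eq)
  also have "\<dots> = ?c * ?x"
    using N B B0 \<open>?c \<noteq> 0\<close> by (simp add: eq field_simps)
  finally have "cmod ?c * cmod ?x \<le> \<eta>"
    using small by (metis norm_mult)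
  moreover have "1 / 2 * cmod ?x \<le> cmod ?c * cmod ?x"
    using c by (rule mult_right_mono) simp
  ultimately show ?thesis
    by linarith
qed

section \<open>Measurability of the spectrum\<close>

text \<open>
  The condition ranges over uncountably many \<open>z\<close>. By compactness, a zero exists in \<open>C\<close> if and only if \<open>p \<omega>\<close>
  takes arbitrarily small values on a countable dense subset of \<open>C\<close>.
\<close>

lemma sets_Collect_zero_in_compact:
  fixes p :: "'w \<Rightarrow> 'a :: {metric_space, second_countable_topology} \<Rightarrow> 'b :: {real_normed_vector, second_countable_topology}"
  assumes C: "compact C"
    and cont: "\<And>\<omega>. \<omega> \<in> space M \<Longrightarrow> continuous_on C (p \<omega>)"
    and meas: "\<And>z. (\<lambda>\<omega>. p \<omega> z) \<in> borel_measurable M"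
  shows "{\<omega> \<in> space M. \<exists>z\<in>C. p \<omega> z = 0} \<in> sets M"
proof -
  obtain T where T: "countable T" "T \<subseteq> C" "C \<subseteq> closure T"
    using separable[of C] by blast
  have "(\<exists>z\<in>C. p \<omega> z = 0) \<longleftrightarrow> (\<forall>k::nat. \<exists>z\<in>T. norm (p \<omega> z) < 1 / Suc k)"
    if \<omega>: "\<omega> \<in> space M" for \<omega>
  proof
    assume "\<exists>z\<in>C. p \<omega> z = 0"
    then obtain z where z: "z \<in> C" "p \<omega> z = 0"
      by blast
    show "\<forall>k::nat. \<exists>z\<in>T. norm (p \<omega> z) < 1 / Suc k"
    proof
      fix k :: nat
      obtain d where d: "d > 0" "\<And>y. y \<in> C \<Longrightarrow> dist y z < d \<Longrightarrow> dist (p \<omega> y) (p \<omega> z) < 1 / Suc k"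
        using cont[OF \<omega>] z(1) unfolding continuous_on_iff by (metis of_nat_0_less_iff zero_less_Suc zero_less_divide_1_iff)
      obtain y where "y \<in> T" "dist y z < d"
        using z(1) T(3) d(1) by (meson closure_approachable subsetD)
      then show "\<exists>z\<in>T. norm (p \<omega> z) < 1 / Suc k"
        using d(2)[of y] T(2) z(2) by auto
    qed
  next
    assume approx: "\<forall>k::nat. \<exists>z\<in>T. norm (p \<omega> z) < 1 / Suc k"
    then have "C \<noteq> {}"
      using T(2) by blast
    then obtain x where x: "x \<in> C" "\<And>y. y \<in> C \<Longrightarrow> norm (p \<omega> x) \<le> norm (p \<omega> y)"
      using continuous_attains_inf[OF C _ continuous_on_norm[OF cont[OF \<omega>]]] by blast
    have "p \<omega> x = 0"
    proof (rule ccontr)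
      assume "p \<omega> x \<noteq> 0"
      then obtain k :: nat where "1 / Suc k < norm (p \<omega> x)"
        using nat_approx_posE[of "norm (p \<omega> x)"] by auto
      then show False
        using approx x(2) T(2) by (meson less_trans linorder_not_less subsetD)
    qed
    then show "\<exists>z\<in>C. p \<omega> z = 0"
      using x by blast
  qed
  then have "{\<omega> \<in> space M. \<exists>z\<in>C. p \<omega> z = 0}
      = (\<Inter>k::nat. \<Union>z\<in>T. {\<omega> \<in> space M. norm (p \<omega> z) < 1 / Suc k})"
    by auto
  also have "\<dots> \<in> sets M"
    using T(1) meas
    by (intro sets.countable_INT sets.countable_UN'' image_subsetI borel_measurable_less
        borel_measurable_norm borel_measurable_const) auto
  finally show ?thesis .
qed

text \<open>
  A finite set has at least \<open>k\<close> elements if and only if it meets each of \<open>k\<close> pairwise disjoint balls. The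
  balls can be taken from a countable family, with centres in a countable dense set and radii
  \<open>1 / (n + 1)\<close>.
\<close>

lemma sets_Collect_card_random_finite_set_ge:
  fixes S :: "'w \<Rightarrow> 'a :: euclidean_space set"
  assumes fin: "\<And>\<omega>. \<omega> \<in> space M \<Longrightarrow> finite (S \<omega>)"
    and hit: "\<And>C. compact C \<Longrightarrow> {\<omega> \<in> space M. S \<omega> \<inter> C \<noteq> {}} \<in> sets M"
  shows "{\<omega> \<in> space M. k \<le> card (S \<omega>)} \<in> sets M"
proof -
  obtain Q :: "'a set" where Q: "countable Q" "UNIV \<subseteq> closure Q"
    using separable[of "UNIV :: 'a set"] by metis
  define \<B> where "\<B> = (\<lambda>(q, n). cball q (1 / real (Suc n))) ` (Q \<times> (UNIV :: nat set))"
  define \<F> where "\<F> = {F. finite F \<and> F \<subseteq> \<B> \<and> card F = k \<and> disjoint F}"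
  have "countable \<B>"
    unfolding \<B>_def using Q(1) by (intro countable_image countable_SIGMA) auto
  then have countable: "countable \<F>"
    by (rule countable_subset[rotated, OF countable_Collect_finite_subset]) (auto simp: \<F>_def)
  have compact: "compact B" if "B \<in> \<B>" for B
    using that by (auto simp: \<B>_def)
  have "k \<le> card (S \<omega>) \<longleftrightarrow> (\<exists>F\<in>\<F>. \<forall>B\<in>F. S \<omega> \<inter> B \<noteq> {})" if \<omega>: "\<omega> \<in> space M" for \<omega>
  proof
    assume "k \<le> card (S \<omega>)"
    then obtain T where T: "T \<subseteq> S \<omega>" "card T = k" "finite T"
      using obtain_subset_with_card_n by metis
    obtain e where e: "e > 0" "\<And>x y. x \<in> T \<Longrightarrow> y \<in> T \<Longrightarrow> dist x y < e \<Longrightarrow> x = y"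
      using T(3) uniform_discrete_finite_iff unfolding uniform_discrete_def by metis
    \<comment> \<open>Points of \<open>T\<close> whose balls meet are linked by four segments of length at most \<open>1 / (n + 1)\<close>.\<close>
    obtain n where n: "1 / real (Suc n) < e / 4"
      using nat_approx_posE[of "e / 4"] e(1) by auto
    have "\<exists>q\<in>Q. dist q x < 1 / real (Suc n)" for x
      using Q(2) by (metis UNIV_I closure_approachable of_nat_0_less_iff subsetD zero_less_Suc zero_less_divide_1_iff)
    then obtain q where q: "\<And>x. q x \<in> Q" "\<And>x. dist (q x) x < 1 / real (Suc n)"
      by metis
    define b where "b x = cball (q x) (1 / real (Suc n))" for x
    have mem: "x \<in> b x" for x
      using q(2)[of x] by (simp add: b_def less_imp_le)
    have sep: "x = y" if "x \<in> T" "y \<in> T" "z \<in> b x" "z \<in> b y" for x y z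
    proof (rule e(2)[OF that(1,2)])
      have "dist x y \<le> dist (q x) x + dist (q x) z + dist (q y) z + dist (q y) y"
        using dist_triangle[of x y "q x"] dist_triangle[of "q x" y z] dist_triangle[of z y "q y"]
        by (simp add: dist_commute)
      also have "\<dots> < e"
        using q(2)[of x] q(2)[of y] that(3,4) n by (simp add: b_def)
      finally show "dist x y < e" .
    qed
    have "inj_on b T"
      using sep mem by (metis inj_onI)
    moreover have "disjoint (b ` T)"
      using sep by (fastforce simp: disjoint_def)
    moreover have "b x \<in> \<B>" for x
      using q(1) unfolding \<B>_def b_def by (intro image_eqI[of _ _ "(q x, n)"]) auto
    ultimately have "b ` T \<in> \<F>"
      using T by (auto simp: \<F>_def card_image)
    then show "\<exists>F\<in>\<F>. \<forall>B\<in>F. S \<omega> \<inter> B \<noteq> {}"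
      using mem T(1) by (intro bexI[of _ "b ` T"]) auto
  next
    assume "\<exists>F\<in>\<F>. \<forall>B\<in>F. S \<omega> \<inter> B \<noteq> {}"
    then obtain F where F: "F \<in> \<F>" and "\<forall>B\<in>F. \<exists>x. x \<in> S \<omega> \<inter> B"
      by blast
    then obtain f where f: "\<And>B. B \<in> F \<Longrightarrow> f B \<in> S \<omega> \<inter> B"
      by metis
    have "inj_on f F"
    proof (rule inj_onI)
      fix B B' assume "B \<in> F" "B' \<in> F" "f B = f B'"
      then have "f B \<in> B \<inter> B'"
        using f by (metis IntD2 IntI)
      then show "B = B'"
        using F \<open>B \<in> F\<close> \<open>B' \<in> F\<close> by (auto simp: \<F>_def disjoint_def)
    qed
    then have "card F \<le> card (S \<omega>)"
      using f by (intro card_inj_on_le[OF _ _ fin[OF \<omega>]]) auto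
    then show "k \<le> card (S \<omega>)"
      using F by (simp add: \<F>_def)
  qed
  then have "{\<omega> \<in> space M. k \<le> card (S \<omega>)}
      = (\<Union>F\<in>\<F>. {\<omega> \<in> space M. \<forall>B\<in>F. S \<omega> \<inter> B \<noteq> {}})"
    by auto
  also have "\<dots> \<in> sets M"
  proof (rule sets.countable_UN''[OF countable])
    show "{\<omega> \<in> space M. \<forall>B\<in>F. S \<omega> \<inter> B \<noteq> {}} \<in> sets M" if "F \<in> \<F>" for F
      using that compact by (intro sets.sets_Collect_finite_All hit) (auto simp: \<F>_def)
  qed
  finally show ?thesis .
qed

lemma borel_measurable_det:
  fixes A :: "'w \<Rightarrow> complex mat"
  assumes A: "\<And>\<omega>. \<omega> \<in> space M \<Longrightarrow> A \<omega> \<in> carrier_mat n n"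
    and meas: "\<And>i j. i < n \<Longrightarrow> j < n \<Longrightarrow> (\<lambda>\<omega>. A \<omega> $$ (i, j)) \<in> borel_measurable M"
  shows "(\<lambda>\<omega>. Determinant.det (A \<omega>)) \<in> borel_measurable M"
proof -
  have "(\<lambda>\<omega>. \<Sum>p\<in>{p. p permutes {0..<n}}. signof p * (\<Prod>i=0..<n. A \<omega> $$ (i, p i)))
      \<in> borel_measurable M"
    using meas by (intro borel_measurable_sum borel_measurable_times borel_measurable_const borel_measurable_prod)
      (auto simp: permutes_in_image)
  then show ?thesis
    by (rule measurable_cong[THEN iffD2, rotated]) (use A det_def' in blast)
qed

lemma borel_measurable_cofactor:
  fixes A :: "'w \<Rightarrow> complex mat"
  assumes A: "\<And>\<omega>. \<omega> \<in> space M \<Longrightarrow> A \<omega> \<in> carrier_mat n n"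
    and meas: "\<And>i j. i < n \<Longrightarrow> j < n \<Longrightarrow> (\<lambda>\<omega>. A \<omega> $$ (i, j)) \<in> borel_measurable M"
  shows "(\<lambda>\<omega>. Determinant.cofactor (A \<omega>) k l) \<in> borel_measurable M"
proof -
  have "(\<lambda>\<omega>. Determinant.det (mat_delete (A \<omega>) k l)) \<in> borel_measurable M"
  proof (rule borel_measurable_det)
    show "mat_delete (A \<omega>) k l \<in> carrier_mat (n - 1) (n - 1)" if "\<omega> \<in> space M" for \<omega>
      using mat_delete_carrier[OF A[OF that]] .
    show "(\<lambda>\<omega>. mat_delete (A \<omega>) k l $$ (i, j)) \<in> borel_measurable M"
      if ij: "i < n - 1" "j < n - 1" for i j
    proof -
      let ?i = "if i < k then i else Suc i" and ?j = "if j < l then j else Suc j"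
      have "(\<lambda>\<omega>. A \<omega> $$ (?i, ?j)) \<in> borel_measurable M"
        using ij by (intro meas) auto
      moreover have "mat_delete (A \<omega>) k l $$ (i, j) = A \<omega> $$ (?i, ?j)" if "\<omega> \<in> space M" for \<omega>
        using A[OF that] ij by (auto simp: mat_delete_def)
      ultimately show ?thesis
        by (subst measurable_cong) assumption+
    qed
  qed
  then show ?thesis
    unfolding Determinant.cofactor_def by (intro borel_measurable_times borel_measurable_const)
qed

lemma sets_Collect_spectrum_meets_compact:
  fixes A :: "'w \<Rightarrow> complex mat"
  assumes A: "\<And>\<omega>. \<omega> \<in> space M \<Longrightarrow> A \<omega> \<in> carrier_mat n n"
    and meas: "\<And>i j. i < n \<Longrightarrow> j < n \<Longrightarrow> (\<lambda>\<omega>. A \<omega> $$ (i, j)) \<in> borel_measurable M"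
    and C: "compact C"
  shows "{\<omega> \<in> space M. spectrum (A \<omega>) \<inter> C \<noteq> {}} \<in> sets M"
proof -
  let ?p = "\<lambda>\<omega>. poly (char_poly (A \<omega>))"
  have "?p \<omega> z = Determinant.det (- (char_matrix (A \<omega>) z))" if "\<omega> \<in> space M" for \<omega> z
    using char_poly_matrix[OF A[OF that]] .
  moreover have "(\<lambda>\<omega>. Determinant.det (- (char_matrix (A \<omega>) z))) \<in> borel_measurable M" for z
  proof (rule borel_measurable_det[of _ _ n])
    show "(\<lambda>\<omega>. (- char_matrix (A \<omega>) z) $$ (i, j)) \<in> borel_measurable M" if ij: "i < n" "j < n" for i j
    proof -
      have "(\<lambda>\<omega>. - (A \<omega> $$ (i, j) - (if i = j then z else 0))) \<in> borel_measurable M"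
        using meas[OF ij] by simp
      moreover have "(- char_matrix (A \<omega>) z) $$ (i, j) = - (A \<omega> $$ (i, j) - (if i = j then z else 0))"
        if "\<omega> \<in> space M" for \<omega>
        using A[OF that] ij by (auto simp: char_matrix_def)
      ultimately show ?thesis
        by (subst measurable_cong) assumption+
    qed
  qed (use A in auto)
  ultimately have "(\<lambda>\<omega>. ?p \<omega> z) \<in> borel_measurable M" for z
    by (simp cong: measurable_cong)
  then have "{\<omega> \<in> space M. \<exists>z\<in>C. ?p \<omega> z = 0} \<in> sets M"
    by (intro sets_Collect_zero_in_compact[OF C] continuous_intros)
  also have "{\<omega> \<in> space M. \<exists>z\<in>C. ?p \<omega> z = 0} = {\<omega> \<in> space M. spectrum (A \<omega>) \<inter> C \<noteq> {}}"
    using A spectrum_root_char_poly by blast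
  finally show ?thesis .
qed

text \<open>
  The complement of the disc is a countable union of compact annuli.
\<close>

lemma sets_Collect_spectrum_subset_cball:
  fixes A :: "'w \<Rightarrow> complex mat"
  assumes A: "\<And>\<omega>. \<omega> \<in> space M \<Longrightarrow> A \<omega> \<in> carrier_mat n n"
    and meas: "\<And>i j. i < n \<Longrightarrow> j < n \<Longrightarrow> (\<lambda>\<omega>. A \<omega> $$ (i, j)) \<in> borel_measurable M"
  shows "{\<omega> \<in> space M. spectrum (A \<omega>) \<subseteq> cball 0 R} \<in> sets M"
proof -
  define C where "C k = cball (0 :: complex) (real k) - ball 0 (R + 1 / real (Suc k))" for k
  have "(\<exists>k. z \<in> C k) \<longleftrightarrow> z \<notin> cball 0 R" for z
  proof
    assume "z \<notin> cball 0 R"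
    then obtain m :: nat where m: "1 / real (Suc m) < cmod z - R"
      using nat_approx_posE[of "cmod z - R"] by auto
    obtain l :: nat where l: "cmod z \<le> real l"
      using real_arch_simple by blast
    have "1 / real (Suc (max m l)) \<le> 1 / real (Suc m)"
      by (intro divide_left_mono) auto
    then have "z \<in> C (max m l)"
      using m l by (auto simp: C_def)
    then show "\<exists>k. z \<in> C k" ..
  next
    assume "\<exists>k. z \<in> C k"
    then obtain k where "z \<in> C k" ..
    then have "R + 1 / real (Suc k) \<le> cmod z"
      by (simp add: C_def)
    moreover have "0 < 1 / real (Suc k)"
      by simp
    ultimately have "R < cmod z"
      by linarith
    then show "z \<notin> cball 0 R"
      by simp
  qed
  then have "{\<omega> \<in> space M. spectrum (A \<omega>) \<subseteq> cball 0 R}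
      = space M - (\<Union>k. {\<omega> \<in> space M. spectrum (A \<omega>) \<inter> C k \<noteq> {}})"
    by blast
  also have "\<dots> \<in> sets M"
    by (intro sets.compl_sets sets.countable_UN image_subsetI sets_Collect_spectrum_meets_compact[OF A meas])
      (auto simp: C_def compact_diff)
  finally show ?thesis .
qed

lemma sets_Collect_card_spectrum_cball_le:
  fixes A :: "'w \<Rightarrow> complex mat"
  assumes A: "\<And>\<omega>. \<omega> \<in> space M \<Longrightarrow> A \<omega> \<in> carrier_mat n n"
    and meas: "\<And>i j. i < n \<Longrightarrow> j < n \<Longrightarrow> (\<lambda>\<omega>. A \<omega> $$ (i, j)) \<in> borel_measurable M"
  shows "{\<omega> \<in> space M. real (card (spectrum (A \<omega>) \<inter> cball 0 r)) \<le> c} \<in> sets M"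
proof -
  have "{\<omega> \<in> space M. k \<le> card (spectrum (A \<omega>) \<inter> cball 0 r)} \<in> sets M" for k
  proof (rule sets_Collect_card_random_finite_set_ge)
    show "finite (spectrum (A \<omega>) \<inter> cball 0 r)" if "\<omega> \<in> space M" for \<omega>
      using card_finite_spectrum(1)[OF A[OF that]] by blast
    show "{\<omega> \<in> space M. spectrum (A \<omega>) \<inter> cball 0 r \<inter> C \<noteq> {}} \<in> sets M" if "compact C" for C
      unfolding Int_assoc using that
      by (intro sets_Collect_spectrum_meets_compact[OF A meas] compact_Int) auto
  qed
  then have "space M - (\<Union>k\<in>{k. c < real k}. {\<omega> \<in> space M. k \<le> card (spectrum (A \<omega>) \<inter> cball 0 r)}) \<in> sets M"
    by (intro sets.compl_sets sets.countable_UN) auto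
  also have "space M - (\<Union>k\<in>{k. c < real k}. {\<omega> \<in> space M. k \<le> card (spectrum (A \<omega>) \<inter> cball 0 r)})
      = {\<omega> \<in> space M. real (card (spectrum (A \<omega>) \<inter> cball 0 r)) \<le> c}"
    by (force simp: not_le)
  finally show ?thesis .
qed

section \<open>Gaussian random variables\<close>

text \<open>
  The exact value is \<open>1\<close>. The bound \<open>4\<close> can be had without evaluating an integral: by
  \<open>x exp (- x) \<le> 2 exp (- x / 2)\<close> the integrand is at most \<open>2 f (z / \<surd>2)\<close> where \<open>f\<close> is the density,
  and scaling the plane by \<open>\<surd>2\<close> doubles the total mass \<open>1\<close> of \<open>f\<close>.
\<close>

lemma std_complex_gaussian_second_moment_le:
  assumes "prob_space M" and X: "distributed M lborel X std_complex_gaussian_density"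
  shows "(\<integral>\<^sup>+\<omega>. ennreal ((cmod (X \<omega>))\<^sup>2) \<partial>M) \<le> 4"
proof -
  interpret prob_space M by fact
  let ?f = std_complex_gaussian_density
  have f_nonneg: "0 \<le> ?f z" for z
    by (simp add: std_complex_gaussian_density_def)
  have [measurable]: "?f \<in> borel_measurable borel"
    unfolding std_complex_gaussian_density_def[abs_def] by measurable
  have total: "(\<integral>\<^sup>+z. ennreal (?f z) \<partial>lborel) = 1"
    using distributed_nn_integral[OF X, of "\<lambda>_. 1"] by (simp add: emeasure_space_1)
  have dom: "?f z * (cmod z)\<^sup>2 \<le> 2 * ?f ((1 / sqrt 2) *\<^sub>R z)" for z
  proof -
    define x where "x = (cmod z)\<^sup>2"
    have "x \<le> 2 * exp (x / 2)"
      using exp_ge_add_one_self[of "x / 2"] by linarith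
    then have "exp (- x) * x \<le> exp (- x) * (2 * exp (x / 2))"
      by (intro mult_left_mono) auto
    also have "\<dots> = 2 * exp (- x / 2)"
      by (simp flip: exp_add)
    finally have "exp (- x) * x \<le> 2 * exp (- x / 2)" .
    then have "exp (- x) / pi * x \<le> 2 * (exp (- (x / 2)) / pi)"
      using divide_right_mono[of "exp (- x) * x" "2 * exp (- x / 2)" pi] by simp
    moreover have "(cmod ((1 / sqrt 2) *\<^sub>R z))\<^sup>2 = x / 2"
      by (simp add: x_def power_divide)
    ultimately show ?thesis
      unfolding std_complex_gaussian_density_def by (simp only: x_def)
  qed
  have "(\<integral>\<^sup>+\<omega>. ennreal ((cmod (X \<omega>))\<^sup>2) \<partial>M) = (\<integral>\<^sup>+z. ennreal (?f z) * ennreal ((cmod z)\<^sup>2) \<partial>lborel)"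
    by (rule distributed_nn_integral[OF X, symmetric]) auto
  also have "\<dots> \<le> (\<integral>\<^sup>+z. 2 * ennreal (?f ((1 / sqrt 2) *\<^sub>R z)) \<partial>lborel)"
  proof (rule nn_integral_mono)
    fix z :: complex
    have "ennreal (?f z) * ennreal ((cmod z)\<^sup>2) = ennreal (?f z * (cmod z)\<^sup>2)"
      by (simp add: ennreal_mult f_nonneg)
    also have "\<dots> \<le> ennreal (2 * ?f ((1 / sqrt 2) *\<^sub>R z))"
      using dom by (rule ennreal_leI)
    also have "\<dots> = 2 * ennreal (?f ((1 / sqrt 2) *\<^sub>R z))"
      by (simp add: ennreal_mult f_nonneg)
    finally show "ennreal (?f z) * ennreal ((cmod z)\<^sup>2) \<le> 2 * ennreal (?f ((1 / sqrt 2) *\<^sub>R z))" .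
  qed
  also have "\<dots> = 2 * (\<integral>\<^sup>+z. ennreal (?f ((1 / sqrt 2) *\<^sub>R z)) \<partial>lborel)"
    by (rule nn_integral_cmult) measurable
  also have "(\<integral>\<^sup>+z. ennreal (?f ((1 / sqrt 2) *\<^sub>R z)) \<partial>lborel) = (\<integral>\<^sup>+z. 2 * ennreal (?f z) \<partial>lborel)"
    by (subst lborel_affine[of "sqrt 2" 0])
      (auto simp: nn_integral_density nn_integral_distr)
  also have "\<dots> = 2"
    using total by (simp add: nn_integral_cmult)
  finally show ?thesis
    by simp
qed

text \<open>
  The density is at most \<open>1 / \<pi>\<close> and the disc has area \<open>\<pi> s\<^sup>2\<close>.
\<close>

lemma std_complex_gaussian_small_ball:
  assumes "prob_space M" and X: "distributed M lborel X std_complex_gaussian_density" and s: "0 \<le> s"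
  shows "emeasure (distr M borel X) (cball w s) \<le> ennreal (s\<^sup>2)"
proof -
  have "emeasure (distr M borel X) (cball w s) = emeasure M (X -` cball w s \<inter> space M)"
    using X by (subst emeasure_distr) (auto simp: distributed_def)
  also have "\<dots> = (\<integral>\<^sup>+z. ennreal (std_complex_gaussian_density z) * indicator (cball w s) z \<partial>lborel)"
    by (rule distributed_emeasure[OF X]) auto
  also have "\<dots> \<le> (\<integral>\<^sup>+z. ennreal (1 / pi) * indicator (cball w s) z \<partial>lborel)"
    by (intro nn_integral_mono mult_right_mono ennreal_leI)
      (auto simp: std_complex_gaussian_density_def divide_right_mono)
  also have "\<dots> = ennreal (1 / pi) * ennreal (pi * s\<^sup>2)"
    using s by (simp add: nn_integral_cmult_indicator emeasure_cball unit_ball_vol_2)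
  also have "\<dots> = ennreal (s\<^sup>2)"
    by (simp flip: ennreal_mult')
  finally show ?thesis .
qed

text \<open>
  Fubini's theorem for the joint law of \<open>X\<close> and \<open>W\<close>, which is a product, extends the bound to random centres.
\<close>

lemma std_complex_gaussian_small_ball_indep:
  assumes "prob_space M" and X: "distributed M lborel X std_complex_gaussian_density"
    and indep: "prob_space.indep_var M borel X borel (W :: 'w \<Rightarrow> complex)" and s: "0 \<le> s"
  shows "measure M {\<omega> \<in> space M. cmod (X \<omega> - W \<omega>) \<le> s} \<le> s\<^sup>2"
proof -
  interpret prob_space M by fact
  note joint = iffD1[OF indep_var_distribution_eq indep]
  have [measurable]: "X \<in> borel_measurable M" "W \<in> borel_measurable M"
    using joint by auto
  interpret X: prob_space "distr M borel X"
    by (rule prob_space_distr) measurable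
  interpret W: prob_space "distr M borel W"
    by (rule prob_space_distr) measurable
  interpret P: pair_prob_space "distr M borel X" "distr M borel W" ..
  let ?E = "{(x, w). cmod (x - w) \<le> s}"
  have "(\<lambda>(x, w). cmod (x - w)) -` {..s} \<inter> space (borel \<Otimes>\<^sub>M borel) \<in> sets (borel \<Otimes>\<^sub>M borel)"
    by (rule measurable_sets[of _ _ borel]) auto
  also have "(\<lambda>(x, w). cmod (x - w)) -` {..s} \<inter> space (borel \<Otimes>\<^sub>M borel) = ?E"
    by (auto simp: space_pair_measure)
  finally have E: "?E \<in> sets (borel \<Otimes>\<^sub>M borel)" .
  have "emeasure M {\<omega> \<in> space M. cmod (X \<omega> - W \<omega>) \<le> s}
      = emeasure (distr M (borel \<Otimes>\<^sub>M borel) (\<lambda>\<omega>. (X \<omega>, W \<omega>))) ?E"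
    by (subst emeasure_distr[OF _ E]) (auto intro!: arg_cong[of _ _ "emeasure M"])
  also have "\<dots> = emeasure (distr M borel X \<Otimes>\<^sub>M distr M borel W) ?E"
    using joint by simp
  also have "\<dots> = (\<integral>\<^sup>+w. emeasure (distr M borel X) ((\<lambda>x. (x, w)) -` ?E) \<partial>distr M borel W)"
    using E by (intro P.emeasure_pair_measure_alt2) (simp cong: sets_pair_measure_cong)
  also have "\<dots> \<le> (\<integral>\<^sup>+w. ennreal (s\<^sup>2) \<partial>distr M borel W)"
  proof (rule nn_integral_mono)
    fix w :: complex
    have "(\<lambda>x. (x, w)) -` ?E = cball w s"
      by (auto simp: dist_norm norm_minus_commute)
    then show "emeasure (distr M borel X) ((\<lambda>x. (x, w)) -` ?E) \<le> ennreal (s\<^sup>2)"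
      using std_complex_gaussian_small_ball[OF assms(1) X s] by simp
  qed
  also have "\<dots> = ennreal (s\<^sup>2)"
    using W.emeasure_space_1 by simp
  finally show ?thesis
    by (simp add: emeasure_eq_measure)
qed

lemma prob_sum_norm_square_ge:
  assumes "prob_space M" and "finite I" and "0 < a"
    and X: "\<And>i. i \<in> I \<Longrightarrow> distributed M lborel (X i) std_complex_gaussian_density"
  shows "measure M {\<omega> \<in> space M. a \<le> (\<Sum>i\<in>I. (cmod (X i \<omega>))\<^sup>2)} \<le> 4 * real (card I) / a"
proof -
  interpret prob_space M by fact
  have [measurable]: "X i \<in> borel_measurable M" if "i \<in> I" for i
    using X[OF that] by (simp add: distributed_def)
  let ?u = "\<lambda>\<omega>. \<Sum>i\<in>I. (cmod (X i \<omega>))\<^sup>2"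
  have "{\<omega> \<in> space M. a \<le> ?u \<omega>} = {\<omega> \<in> space M. 1 \<le> ennreal (1 / a) * ennreal (?u \<omega>)}"
    using \<open>0 < a\<close> by (auto simp: sum_nonneg field_simps simp flip: ennreal_mult' ennreal_1)
  then have "emeasure M {\<omega> \<in> space M. a \<le> ?u \<omega>}
      \<le> ennreal (1 / a) * (\<integral>\<^sup>+\<omega>. ennreal (?u \<omega>) * indicator (space M) \<omega> \<partial>M)"
    by (simp only:) (rule nn_integral_Markov_inequality, auto)
  also have "(\<integral>\<^sup>+\<omega>. ennreal (?u \<omega>) * indicator (space M) \<omega> \<partial>M) = (\<integral>\<^sup>+\<omega>. (\<Sum>i\<in>I. ennreal ((cmod (X i \<omega>))\<^sup>2)) \<partial>M)"
    by (intro nn_integral_cong) simp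
  also have "\<dots> = (\<Sum>i\<in>I. \<integral>\<^sup>+\<omega>. ennreal ((cmod (X i \<omega>))\<^sup>2) \<partial>M)"
    by (rule nn_integral_sum) measurable
  also have "\<dots> \<le> (\<Sum>i\<in>I. 4)"
    by (intro sum_mono std_complex_gaussian_second_moment_le[OF assms(1) X])
  also have "ennreal (1 / a) * (\<Sum>i\<in>I. 4) = ennreal (4 * real (card I) / a)"
    using \<open>0 < a\<close> by (simp add: field_simps ennreal_of_nat_eq_real_of_nat flip: ennreal_mult' ennreal_numeral)
  finally show ?thesis
    using \<open>0 < a\<close> by (simp add: emeasure_eq_measure mult_left_mono)
qed

section \<open>Probability of a small determinant and the theorem\<close>

text \<open>
  The exceptional set \<open>E\<close> is the event that the lower left entry \<open>X c\<close> of \<open>Kt\<close> lies within \<open>2 \<eta> / d\<close> of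
  the centre \<open>W\<close> given by \<open>corner_entry_near_if_det_small\<close>, rescaled by \<open>d\<close>. As a function of the entries
  with index in \<open>I'\<close>, this centre is independent of \<open>X c\<close>. Where the cofactor vanishes, division by zero
  makes it \<open>0\<close>; the bound on the entries excludes this case.
\<close>

lemma prob_det_perturbed_jordan_small:
  assumes "prob_space M" and N: "0 < N" and Kt: "std_complex_gaussian_matrix M N Kt" and d: "0 < d"
  defines "B \<omega> \<equiv> complex_of_real d \<cdot>\<^sub>m Kt \<omega>"
  assumes \<epsilon>: "\<epsilon> \<le> 1" "real (N - 1) * \<epsilon> \<le> 1 / 2" and \<eta>: "0 \<le> \<eta>"
  obtains E where "E \<in> sets M" "measure M E \<le> (2 * \<eta> / d)\<^sup>2"
    "\<And>\<omega>. \<omega> \<in> space M \<Longrightarrow> (\<Sum>i<N. \<Sum>j<N. cmod (B \<omega> $$ (i, j))) \<le> \<epsilon> \<Longrightarrow>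
       cmod (Determinant.det (jordan_J N + B \<omega>)) \<le> \<eta> \<Longrightarrow> \<omega> \<in> E"
proof -
  interpret prob_space M by fact
  define c :: "nat \<times> nat" where "c = (N - 1, 0)"
  define I' where "I' = {..<N} \<times> {..<N} - {c}"
  define X where "X = (\<lambda>(r, s) \<omega>. Kt \<omega> $$ (r, s))"
  define B0 where "B0 y = mat N N (\<lambda>p. if p = c then 0 else complex_of_real d * y p)"
    for y :: "nat \<times> nat \<Rightarrow> complex"
  define w where "w y = - Determinant.det (jordan_J N + B0 y)
      / Determinant.cofactor (jordan_J N + B0 y) (N - 1) 0 / complex_of_real d" for y
  define W where "W \<omega> = w (\<lambda>p\<in>I'. X p \<omega>)" for \<omega>
  have c: "c \<in> {..<N} \<times> {..<N}"
    using N by (auto simp: c_def)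
  have carrier: "Kt \<omega> \<in> carrier_mat N N" if "\<omega> \<in> space M" for \<omega>
    using Kt that by (simp add: std_complex_gaussian_matrix_def)
  have "w \<in> borel_measurable (PiM I' (\<lambda>_. borel))"
  proof -
    have carrier0: "jordan_J N + B0 y \<in> carrier_mat N N" for y
      by (simp add: B0_def jordan_J_def)
    have entries: "(\<lambda>y. (jordan_J N + B0 y) $$ (i, j)) \<in> borel_measurable (PiM I' (\<lambda>_. borel))"
      if ij: "i < N" "j < N" for i j
    proof (cases "(i, j) = c")
      case True
      then show ?thesis
        using ij by (auto simp: B0_def jordan_J_def c_def)
    next
      case False
      then have [measurable]: "(\<lambda>y. y (i, j)) \<in> borel_measurable (PiM I' (\<lambda>_. borel :: complex measure))"
        using ij by (intro measurable_component_singleton) (auto simp: I'_def)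
      show ?thesis
        using ij False by (simp add: B0_def jordan_J_def)
    qed
    show ?thesis
      unfolding w_def[abs_def]
      by (intro borel_measurable_divide borel_measurable_uminus borel_measurable_const
          borel_measurable_det[OF carrier0 entries] borel_measurable_cofactor[OF carrier0 entries])
  qed
  moreover have "indep_vars (\<lambda>_. borel) X ({..<N} \<times> {..<N})"
    using Kt by (simp add: std_complex_gaussian_matrix_def X_def)
  then have "indep_var (PiM {c} (\<lambda>_. borel)) (\<lambda>\<omega>. \<lambda>p\<in>{c}. X p \<omega>) (PiM I' (\<lambda>_. borel)) (\<lambda>\<omega>. \<lambda>p\<in>I'. X p \<omega>)"
    by (rule indep_var_restrict) (use c in \<open>auto simp: I'_def\<close>)
  ultimately have "indep_var borel ((\<lambda>f. f c) \<circ> (\<lambda>\<omega>. \<lambda>p\<in>{c}. X p \<omega>)) borel (w \<circ> (\<lambda>\<omega>. \<lambda>p\<in>I'. X p \<omega>))"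
    by (intro indep_var_compose measurable_component_singleton) auto
  then have indep: "indep_var borel (X c) borel W"
    by (simp add: comp_def W_def[abs_def])
  have dist: "distributed M lborel (X c) std_complex_gaussian_density"
    using Kt N by (simp add: std_complex_gaussian_matrix_def X_def c_def)
  have [measurable]: "X c \<in> borel_measurable M" "W \<in> borel_measurable M"
    using indep_var_rv1[OF indep] indep_var_rv2[OF indep] by auto
  show thesis
  proof (rule that[of "{\<omega> \<in> space M. cmod (X c \<omega> - W \<omega>) \<le> 2 * \<eta> / d}"])
    show "{\<omega> \<in> space M. cmod (X c \<omega> - W \<omega>) \<le> 2 * \<eta> / d} \<in> sets M"
      by measurable
    show "measure M {\<omega> \<in> space M. cmod (X c \<omega> - W \<omega>) \<le> 2 * \<eta> / d} \<le> (2 * \<eta> / d)\<^sup>2"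
      using \<eta> d by (intro std_complex_gaussian_small_ball_indep[OF assms(1) dist indep]) simp
  next
    fix \<omega>
    assume \<omega>: "\<omega> \<in> space M" and S: "(\<Sum>i<N. \<Sum>j<N. cmod (B \<omega> $$ (i, j))) \<le> \<epsilon>"
      and small: "cmod (Determinant.det (jordan_J N + B \<omega>)) \<le> \<eta>"
    let ?B0 = "B0 (\<lambda>p\<in>I'. X p \<omega>)"
    let ?q = "- Determinant.det (jordan_J N + ?B0) / Determinant.cofactor (jordan_J N + ?B0) (N - 1) 0"
    have "cmod (B \<omega> $$ (N - 1, 0) - ?q) \<le> 2 * \<eta>"
    proof (rule corner_entry_near_if_det_small[OF N _ _ _ S \<epsilon> small])
      show "B \<omega> \<in> carrier_mat N N" "?B0 \<in> carrier_mat N N"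
        using carrier[OF \<omega>] by (auto simp: B_def B0_def)
      show "?B0 $$ (i, j) = (if (i, j) = (N - 1, 0) then 0 else B \<omega> $$ (i, j))"
        if "i < N" "j < N" for i j
        using that carrier[OF \<omega>] by (auto simp: B_def B0_def I'_def X_def c_def)
    qed
    also have "B \<omega> $$ (N - 1, 0) - ?q = complex_of_real d * (X c \<omega> - W \<omega>)"
      using N d carrier[OF \<omega>] by (simp add: B_def X_def c_def W_def w_def distrib_left)
    finally have "d * cmod (X c \<omega> - W \<omega>) \<le> 2 * \<eta>"
      using d by (simp add: norm_mult)
    then show "\<omega> \<in> {\<omega> \<in> space M. cmod (X c \<omega> - W \<omega>) \<le> 2 * \<eta> / d}"
      using \<omega> d by (simp add: field_simps)
  qed
qed

theorem theorem3:
  fixes M :: "'w measure" and N :: nat and Kt K :: "'w \<Rightarrow> complex mat" and \<delta> \<sigma> :: real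
  assumes "prob_space M"
    and "N > 2"
    and "std_complex_gaussian_matrix M N Kt"
    and "\<And>\<omega>. K \<omega> = complex_of_real (1 / real N ^ 2) \<cdot>\<^sub>m Kt \<omega>"
    and "0 < \<delta>" and "\<delta> \<le> 1 / real N ^ 3"
    and "\<sigma> > 0"
  shows "measure M {\<omega> \<in> space M.
           spectrum (jordan_J N + complex_of_real \<delta> \<cdot>\<^sub>m K \<omega>)
             \<subseteq> cball 0 ((\<delta> * real N) powr (1 / real N)) \<and>
           real (card (spectrum (jordan_J N + complex_of_real \<delta> \<cdot>\<^sub>m K \<omega>)
                       \<inter> cball 0 ((\<delta> * real N) powr (1 / real N) * exp (- \<sigma>))))
             \<le> 4 / \<sigma> * ln (real N)}
         \<ge> 1 - 26 / real N ^ 2"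
proof -
  interpret prob_space M by fact
  define d where "d = \<delta> / real N ^ 2"
  define \<epsilon> where "\<epsilon> = \<delta> * real N"
  define \<eta> where "\<eta> = \<delta> / real N ^ 3"
  define B where "B \<omega> = complex_of_real d \<cdot>\<^sub>m Kt \<omega>" for \<omega>
  have N: "0 < N" "0 < real N"
    using \<open>N > 2\<close> by auto
  have pos: "0 < d" "0 < \<epsilon>" "0 < \<eta>"
    using N \<open>0 < \<delta>\<close> by (auto simp: d_def \<epsilon>_def \<eta>_def)
  have "\<epsilon> \<le> 1 / real N ^ 3 * real N"
    unfolding \<epsilon>_def using assms(6) N by (intro mult_right_mono) auto
  then have \<epsilon>N: "\<epsilon> \<le> 1 / real N ^ 2"
    using N by (simp add: power2_eq_square power3_eq_cube)
  have "(1 :: real) < real N ^ 2"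
    using \<open>N > 2\<close> by simp
  then have "1 / real N ^ 2 < 1"
    using N by (subst divide_less_eq_1_pos) auto
  with \<epsilon>N have \<epsilon>1: "\<epsilon> < 1"
    by linarith
  have "real (N - 1) * \<epsilon> \<le> real N * (1 / real N ^ 2)"
    using \<epsilon>N pos by (intro mult_mono) auto
  also have "\<dots> \<le> 1 / 2"
    using \<open>N > 2\<close> by (simp add: power2_eq_square field_simps)
  finally have \<epsilon>2: "real (N - 1) * \<epsilon> \<le> 1 / 2" .
  have carrier: "Kt \<omega> \<in> carrier_mat N N" if "\<omega> \<in> space M" for \<omega>
    using assms(3) that by (simp add: std_complex_gaussian_matrix_def)
  have dist: "distributed M lborel (\<lambda>\<omega>. Kt \<omega> $$ p) std_complex_gaussian_density"
    if "p \<in> {..<N} \<times> {..<N}" for p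
    using assms(3) that by (auto simp: std_complex_gaussian_matrix_def)
  have [measurable]: "(\<lambda>\<omega>. Kt \<omega> $$ p) \<in> borel_measurable M" if "p \<in> {..<N} \<times> {..<N}" for p
    using dist[OF that] by (simp add: distributed_def)
  have B: "complex_of_real \<delta> \<cdot>\<^sub>m K \<omega> = B \<omega>" for \<omega>
    unfolding assms(4) B_def d_def by (intro eq_matI) auto

  let ?R = "(\<delta> * real N) powr (1 / real N)"
  let ?good = "{\<omega> \<in> space M. spectrum (jordan_J N + B \<omega>) \<subseteq> cball 0 ?R \<and>
      real (card (spectrum (jordan_J N + B \<omega>) \<inter> cball 0 (?R * exp (- \<sigma>)))) \<le> 4 / \<sigma> * ln (real N)}"
  have A: "jordan_J N + B \<omega> \<in> carrier_mat N N" if "\<omega> \<in> space M" for \<omega>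
    using carrier[OF that] by (simp add: B_def)
  have entries: "(\<lambda>\<omega>. (jordan_J N + B \<omega>) $$ (i, j)) \<in> borel_measurable M" if "i < N" "j < N" for i j
  proof -
    have "(\<lambda>\<omega>. jordan_J N $$ (i, j) + complex_of_real d * Kt \<omega> $$ (i, j)) \<in> borel_measurable M"
      using that by (intro borel_measurable_add borel_measurable_times borel_measurable_const) auto
    moreover have "(jordan_J N + B \<omega>) $$ (i, j) = jordan_J N $$ (i, j) + complex_of_real d * Kt \<omega> $$ (i, j)"
      if "\<omega> \<in> space M" for \<omega>
      using carrier[OF that] \<open>i < N\<close> \<open>j < N\<close> by (simp add: B_def)
    ultimately show ?thesis
      by (subst measurable_cong) assumption+
  qed
  have good: "?good \<in> sets M"
    by (intro sets.sets_Collect_conj sets_Collect_spectrum_subset_cball[OF A entries]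
        sets_Collect_card_spectrum_cball_le[OF A entries])

  \<comment> \<open>The threshold \<open>N ^ 4\<close> is what the Cauchy--Schwarz inequality turns into the bound \<open>\<epsilon>\<close> on the sum of
    the moduli of the entries of \<open>B\<close>.\<close>
  let ?Q = "\<lambda>\<omega>. \<Sum>p\<in>{..<N}\<times>{..<N}. (cmod (Kt \<omega> $$ p))\<^sup>2"
  define E1 where "E1 = {\<omega> \<in> space M. real N ^ 4 \<le> ?Q \<omega>}"
  have E1: "E1 \<in> sets M"
    unfolding E1_def by measurable
  have "prob E1 \<le> 4 * real (card ({..<N} \<times> {..<N})) / real N ^ 4"
    unfolding E1_def using N by (intro prob_sum_norm_square_ge[OF assms(1)] dist) auto
  also have "\<dots> = 4 / real N ^ 2"
    using N by (simp add: field_simps eval_nat_numeral)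
  finally have prob1: "prob E1 \<le> 4 / real N ^ 2" .
  obtain E2 where E2: "E2 \<in> sets M" "prob E2 \<le> (2 * \<eta> / d)\<^sup>2"
    and in_E2: "\<And>\<omega>. \<omega> \<in> space M \<Longrightarrow> (\<Sum>i<N. \<Sum>j<N. cmod (B \<omega> $$ (i, j))) \<le> \<epsilon> \<Longrightarrow>
       cmod (Determinant.det (jordan_J N + B \<omega>)) \<le> \<eta> \<Longrightarrow> \<omega> \<in> E2"
    using prob_det_perturbed_jordan_small[OF assms(1) N(1) assms(3) pos(1) less_imp_le[OF \<epsilon>1] \<epsilon>2
        less_imp_le[OF pos(3)]] unfolding B_def by blast
  have "(2 * \<eta> / d)\<^sup>2 = 4 / real N ^ 2"
    using N \<open>0 < \<delta>\<close> by (simp add: \<eta>_def d_def power2_eq_square power3_eq_cube)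
  with E2 have prob2: "prob E2 \<le> 4 / real N ^ 2"
    by simp

  have "space M - (E1 \<union> E2) \<subseteq> ?good"
  proof
    fix \<omega> assume "\<omega> \<in> space M - (E1 \<union> E2)"
    then have \<omega>: "\<omega> \<in> space M" and Q: "?Q \<omega> \<le> real N ^ 4" and "\<omega> \<notin> E2"
      by (auto simp: E1_def)
    have "(\<Sum>p\<in>{..<N}\<times>{..<N}. cmod (Kt \<omega> $$ p))\<^sup>2 \<le> ?Q \<omega> * real (card ({..<N} \<times> {..<N}))"
      by (rule sum_squared_le_sum_of_squares)
    also have "\<dots> \<le> real N ^ 4 * real N ^ 2"
      using Q by (auto simp: power2_eq_square intro!: mult_mono)
    also have "\<dots> = (real N ^ 3)\<^sup>2"
      by (simp flip: power_add power_mult)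
    finally have l1: "(\<Sum>p\<in>{..<N}\<times>{..<N}. cmod (Kt \<omega> $$ p)) \<le> real N ^ 3"
      by (rule power2_le_imp_le) simp
    have "(\<Sum>i<N. \<Sum>j<N. cmod (B \<omega> $$ (i, j))) = d * (\<Sum>p\<in>{..<N}\<times>{..<N}. cmod (Kt \<omega> $$ p))"
      using carrier[OF \<omega>] pos
      by (simp add: B_def norm_mult sum_distrib_left sum.cartesian_product case_prod_unfold)
    also have "\<dots> \<le> d * real N ^ 3"
      using l1 pos by (intro mult_left_mono) auto
    also have "\<dots> = \<epsilon>"
      using N by (simp add: d_def \<epsilon>_def power2_eq_square power3_eq_cube)
    finally have S: "(\<Sum>i<N. \<Sum>j<N. cmod (B \<omega> $$ (i, j))) \<le> \<epsilon>" .
    have \<eta>: "\<eta> \<le> cmod (Determinant.det (jordan_J N + B \<omega>))"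
      using in_E2[OF \<omega> S] \<open>\<omega> \<notin> E2\<close> by fastforce
    have "B \<omega> \<in> carrier_mat N N"
      using carrier[OF \<omega>] by (simp add: B_def)
    note spec = spectrum_perturbed_jordan[OF N(1) this S pos(2) \<epsilon>1 pos(3) \<eta> \<open>\<sigma> > 0\<close>]
    have "\<epsilon> / \<eta> = real N ^ 4"
      using N \<open>0 < \<delta>\<close> by (simp add: \<epsilon>_def \<eta>_def eval_nat_numeral)
    then have ln: "ln (\<epsilon> / \<eta>) / \<sigma> = 4 / \<sigma> * ln (real N)"
      using N by (simp add: ln_realpow)
    then show "\<omega> \<in> ?good"
      using \<omega> spec(1) spec(2)[unfolded ln] unfolding \<epsilon>_def by blast
  qed
  then have "prob (space M - (E1 \<union> E2)) \<le> prob ?good"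
    by (intro finite_measure_mono good)
  moreover have "prob (space M - (E1 \<union> E2)) = 1 - prob (E1 \<union> E2)"
    using E1 E2 by (intro prob_compl) auto
  moreover have "prob (E1 \<union> E2) \<le> prob E1 + prob E2"
    using E1 E2 by (intro measure_Un_le) auto
  moreover have "4 / real N ^ 2 + 4 / real N ^ 2 \<le> 26 / real N ^ 2"
    using N by (simp add: divide_right_mono flip: add_divide_distrib)
  ultimately show ?thesis
    unfolding B using prob1 prob2 by linarith
qed

end
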